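(* Let $B_{\mathcal M}^+$ be the filter of non-meager downward-closed subsets of $[\omega]^\omega$. Then $\mathbf{cof}(B_{\mathcal M}^+) \ge 2^{\aleph_0}$ and $\mathbf{cof}(B_{\mathcal M}^+) > \mathfrak b$.
   Context: $2^\omega$ carries the product topology (two-point discrete factors); meager means first category in this topology. Subsets of $\omega$ are identified with their characteristic functions, and $[\omega]^\omega \subseteq 2^\omega$ is the set of infinite subsets of $\omega$. For $x,y \subseteq \omega$, write $x \le y$ if $x - y$ is finite. A set $A \subseteq [\omega]^\omega$ is downward-closed if whenever $x \in A$, $y \in [\omega]^\omega$ and $y \le x$, then $y \in A$. $B_{\mathcal M}^+$ is the family of all non-meager downward-closed subsets of $[\omega]^\omega$. The cardinal characteristics of a filter are by definition the corresponding characteristics of the ideal of complements of its members; thus $\mathbf{cof}(B_{\mathcal M}^+)$ is the smallest cardinality of a subfamily $C$ of $B_{\mathcal M}^+$ such that every member of $B_{\mathcal M}^+$ includes (as a subset) some member of $C$. $\mathfrak b$ is the smallest cardinality of a family $F$ of functions $\omega\to\omega$ such that no single function $g:\omega\to\omega$ eventually majorizes each member of $F$, where $g$ eventually majorizes $f$ if $f(n)\le g(n)$ for all sufficiently large $n$. *)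

theory Defs
  imports "HOL-Analysis.Analysis"
begin

unbundle cardinal_syntax

definition nowhere_dense_in :: "'a topology \<Rightarrow> 'a set \<Rightarrow> bool" where
  "nowhere_dense_in X S \<longleftrightarrow> S \<subseteq> topspace X \<and> X interior_of (X closure_of S) = {}"

definition meager_in :: "'a topology \<Rightarrow> 'a set \<Rightarrow> bool" where
  "meager_in X S \<longleftrightarrow> (\<exists>N :: nat \<Rightarrow> 'a set. (\<forall>n. nowhere_dense_in X (N n)) \<and> S = (\<Union>n. N n))"

definition cantor_topology :: "(nat \<Rightarrow> bool) topology" where
  "cantor_topology = product_topology (\<lambda>_. discrete_topology UNIV) UNIV"

text \<open>Families of subsets of the natural numbers are transported to the Cantor space along
  characteristic functions.\<close>

definition meager_family :: "nat set set \<Rightarrow> bool" where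
  "meager_family A \<longleftrightarrow> meager_in cantor_topology ((\<lambda>x n. n \<in> x) ` A)"

definition infinite_subsets :: "nat set set" where
  "infinite_subsets = {x. infinite x}"

definition almost_subset :: "nat set \<Rightarrow> nat set \<Rightarrow> bool" (infix \<open>\<subseteq>*\<close> 50) where
  "x \<subseteq>* y \<longleftrightarrow> finite (x - y)"

definition downward_closed :: "nat set set \<Rightarrow> bool" where
  "downward_closed A \<longleftrightarrow> A \<subseteq> infinite_subsets \<and>
     (\<forall>x\<in>A. \<forall>y\<in>infinite_subsets. y \<subseteq>* x \<longrightarrow> y \<in> A)"

definition B_M_plus :: "nat set set set" where
  "B_M_plus = {A. downward_closed A \<and> \<not> meager_family A}"

text \<open>The least cardinality of a member of a nonempty collection of sets, as a cardinal order
  relation; the choice of the witness matters only up to isomorphism of cardinals.\<close>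

definition least_card :: "'a set set \<Rightarrow> 'a rel" where
  "least_card \<C> = |SOME C. C \<in> \<C> \<and> (\<forall>D\<in>\<C>. |C| \<le>o |D| )|"

lemma least_card_attained:
  assumes "\<C> \<noteq> {}"
  shows "\<exists>C\<in>\<C>. least_card \<C> = |C| \<and> (\<forall>D\<in>\<C>. |C| \<le>o |D| )"
proof -
  have "\<exists>r\<in>card_of ` \<C>. \<forall>r'\<in>card_of ` \<C>. r \<le>o r'"
    by (rule exists_minim_Card_order) (use assms card_of_Card_order in auto)
  then have "\<exists>C. C \<in> \<C> \<and> (\<forall>D\<in>\<C>. |C| \<le>o |D| )"
    by blast
  from someI_ex[OF this] show ?thesis
    unfolding least_card_def by blast
qed

definition cofinal_families :: "'a set set \<Rightarrow> 'a set set set" where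
  "cofinal_families B = {C. C \<subseteq> B \<and> (\<forall>X\<in>B. \<exists>Y\<in>C. Y \<subseteq> X)}"

lemma cofinal_families_nonempty: "cofinal_families B \<noteq> {}"
  unfolding cofinal_families_def by blast

definition cof :: "'a set set \<Rightarrow> 'a set rel" where
  "cof B = least_card (cofinal_families B)"

definition eventually_majorizes :: "(nat \<Rightarrow> nat) \<Rightarrow> (nat \<Rightarrow> nat) \<Rightarrow> bool" where
  "eventually_majorizes g f \<longleftrightarrow> (\<forall>\<^sub>F n in sequentially. f n \<le> g n)"

definition unbounded_families :: "(nat \<Rightarrow> nat) set set" where
  "unbounded_families = {F. \<not> (\<exists>g. \<forall>f\<in>F. eventually_majorizes g f)}"

lemma unbounded_families_nonempty: "unbounded_families \<noteq> {}"
proof -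
  have "\<not> eventually_majorizes g (\<lambda>n. Suc (g n))" for g
    by (simp add: eventually_majorizes_def)
  then have "UNIV \<in> unbounded_families"
    by (auto simp: unbounded_families_def)
  then show ?thesis
    by blast
qed

definition bounding_number :: "(nat \<Rightarrow> nat) rel" where
  "bounding_number = least_card unbounded_families"

end

(* A cofinal family C is defeated by choosing one member x of each set in C so that the sets almost
   containing no chosen x still form a non-meager family. By the block characterization of
   meagerness, this only requires that every sequence of pairwise disjoint finite blocks has an
   infinite union almost containing no x. If C has fewer than continuum many members, any choice
   works, by an almost disjoint family of size continuum. This gives cof >= continuum, and leaves
   only the case that the bounding number is the continuum; there the choice is made by transfinite
   recursion, where fewer than b many co-infinite sets can be handled at each stage. *)

theory Submission
  imports Defs
begin

section \<open>Cylinders, nowhere density and meagerness in the Cantor space\<close>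

definition cantor_cylinder :: "nat \<Rightarrow> (nat \<Rightarrow> bool) \<Rightarrow> (nat \<Rightarrow> bool) set" where
  "cantor_cylinder n z = {f. \<forall>i<n. f i = z i}"

lemma topspace_cantor_topology [simp]: "topspace cantor_topology = UNIV"
  by (simp add: cantor_topology_def)

lemma openin_cantor_cylinder: "openin cantor_topology (cantor_cylinder n z)"
proof -
  define U where "U i = (if i < n then {z i} else UNIV)" for i
  have "cantor_cylinder n z = Pi\<^sub>E UNIV U"
    by (auto simp: cantor_cylinder_def U_def PiE_def Pi_def split: if_splits)
  moreover have "finite {i. U i \<noteq> UNIV}"
    by (rule finite_subset[of _ "{..<n}"]) (auto simp: U_def)
  ultimately show ?thesis
    unfolding cantor_topology_def by (auto simp: openin_PiE_gen)
qed

lemma openin_cantor_topology_cylinder: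
  assumes "openin cantor_topology S" "z \<in> S"
  shows "\<exists>n. cantor_cylinder n z \<subseteq> S"
proof -
  obtain U where U: "finite {i. U i \<noteq> (UNIV :: bool set)}" "z \<in> Pi\<^sub>E UNIV U" "Pi\<^sub>E UNIV U \<subseteq> S"
    using assms unfolding cantor_topology_def openin_product_topology_alt by fastforce
  obtain n where n: "\<And>i. U i \<noteq> UNIV \<Longrightarrow> i < n"
    using U(1) finite_nat_set_iff_bounded[of "{i. U i \<noteq> UNIV}"] by auto
  have "cantor_cylinder n z \<subseteq> Pi\<^sub>E UNIV U"
  proof
    fix f assume "f \<in> cantor_cylinder n z"
    then have "f i \<in> U i" for i
      using n[of i] U(2) by (cases "i < n") (auto simp: cantor_cylinder_def PiE_iff)
    then show "f \<in> Pi\<^sub>E UNIV U" by auto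
  qed
  with U(3) show ?thesis by blast
qed

text \<open>Cylinders form a base. One that is not inside the closure of \<open>N\<close> has a
  point outside the closure, hence a cylinder around that point missing \<open>N\<close>.
  Conversely, an interior point of the closure has a cylinder in which every smaller cylinder meets
  \<open>N\<close>.\<close>

lemma nowhere_dense_in_cantor_iff:
  "nowhere_dense_in cantor_topology N \<longleftrightarrow>
     (\<forall>z n. \<exists>w m. w \<in> cantor_cylinder n z \<and> cantor_cylinder m w \<inter> N = {})"
  (is "?L \<longleftrightarrow> ?R")
proof
  assume L: ?L
  show ?R
  proof (intro allI)
    fix z n
    let ?K = "cantor_topology closure_of N"
    have "\<not> cantor_cylinder n z \<subseteq> ?K"
    proof
      assume "cantor_cylinder n z \<subseteq> ?K"
      then have "cantor_cylinder n z \<subseteq> cantor_topology interior_of ?K"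
        by (simp add: interior_of_maximal openin_cantor_cylinder)
      moreover have "z \<in> cantor_cylinder n z" by (simp add: cantor_cylinder_def)
      ultimately show False using L by (auto simp: nowhere_dense_in_def)
    qed
    then obtain w where w: "w \<in> cantor_cylinder n z" "w \<notin> ?K" by blast
    have "openin cantor_topology (topspace cantor_topology - ?K)"
      by (simp only: openin_diff closedin_closure_of openin_topspace)
    then obtain m where "cantor_cylinder m w \<subseteq> - ?K"
      using openin_cantor_topology_cylinder[of "topspace cantor_topology - ?K" w] w(2) by auto
    moreover have "N \<subseteq> ?K" by (simp add: closure_of_subset)
    ultimately show "\<exists>w m. w \<in> cantor_cylinder n z \<and> cantor_cylinder m w \<inter> N = {}"
      using w(1) by blast
  qed
next
  assume R: ?R
  have False if w: "w \<in> cantor_topology interior_of (cantor_topology closure_of N)" for w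
  proof -
    obtain n where n: "cantor_cylinder n w \<subseteq> cantor_topology interior_of (cantor_topology closure_of N)"
      using openin_cantor_topology_cylinder[OF openin_interior_of w] by blast
    obtain v m where v: "v \<in> cantor_cylinder n w" "cantor_cylinder m v \<inter> N = {}"
      using R by blast
    have "v \<in> cantor_topology closure_of N"
      using subsetD[OF subset_trans[OF n interior_of_subset] v(1)] .
    moreover have "v \<in> cantor_cylinder m v" by (simp add: cantor_cylinder_def)
    ultimately show False
      using v(2) openin_cantor_cylinder[of m v] by (auto simp: in_closure_of)
  qed
  then show ?L unfolding nowhere_dense_in_def by auto
qed

text \<open>The cylinder criterion read through characteristic functions: lying in a common cylinder
  becomes having equal traces on \<open>{..<n}\<close>.\<close>

definition nowhere_dense_family :: "nat set set \<Rightarrow> bool" where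
  "nowhere_dense_family N \<longleftrightarrow>
     (\<forall>z n. \<exists>w m. w \<inter> {..<n} = z \<inter> {..<n} \<and> (\<forall>y. y \<inter> {..<m} = w \<inter> {..<m} \<longrightarrow> y \<notin> N))"

lemma char_in_cantor_cylinder_iff:
  "(\<lambda>i. i \<in> y) \<in> cantor_cylinder n (\<lambda>i. i \<in> z) \<longleftrightarrow> y \<inter> {..<n} = z \<inter> {..<n}"
  by (auto simp: cantor_cylinder_def set_eq_iff)

lemma nowhere_dense_in_char_image:
  "nowhere_dense_in cantor_topology ((\<lambda>x n. n \<in> x) ` N) \<longleftrightarrow> nowhere_dense_family N"
  (is "?L \<longleftrightarrow> ?R")
proof
  assume L: ?L
  show ?R
    unfolding nowhere_dense_family_def
  proof (intro allI)
    fix z n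
    obtain w m where w: "w \<in> cantor_cylinder n (\<lambda>i. i \<in> z)"
        "cantor_cylinder m w \<inter> (\<lambda>x n. n \<in> x) ` N = {}"
      using L unfolding nowhere_dense_in_cantor_iff by blast
    have "Collect w \<inter> {..<n} = z \<inter> {..<n}"
      using w(1) char_in_cantor_cylinder_iff[of "Collect w" n z] by simp
    moreover have "y \<notin> N" if "y \<inter> {..<m} = Collect w \<inter> {..<m}" for y
      using w(2) that char_in_cantor_cylinder_iff[of y m "Collect w"] by (simp add: disjoint_iff image_iff) blast
    ultimately show "\<exists>w m. w \<inter> {..<n} = z \<inter> {..<n} \<and> (\<forall>y. y \<inter> {..<m} = w \<inter> {..<m} \<longrightarrow> y \<notin> N)"
      by blast
  qed
next
  assume R: ?R
  show ?L
    unfolding nowhere_dense_in_cantor_iff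
  proof (intro allI)
    fix z n
    obtain w m where w: "w \<inter> {..<n} = Collect z \<inter> {..<n}"
        "\<And>y. y \<inter> {..<m} = w \<inter> {..<m} \<Longrightarrow> y \<notin> N"
      using R unfolding nowhere_dense_family_def by meson
    have "(\<lambda>i. i \<in> w) \<in> cantor_cylinder n z"
      using w(1) char_in_cantor_cylinder_iff[of w n "Collect z"] by simp
    moreover have "cantor_cylinder m (\<lambda>i. i \<in> w) \<inter> (\<lambda>x n. n \<in> x) ` N = {}"
      using w(2) char_in_cantor_cylinder_iff[of _ m w] by blast
    ultimately show "\<exists>w m. w \<in> cantor_cylinder n z \<and>
        cantor_cylinder m w \<inter> (\<lambda>x n. n \<in> x) ` N = {}"
      by blast
  qed
qed

lemma meager_family_iff:
  "meager_family A \<longleftrightarrow> (\<exists>N :: nat \<Rightarrow> nat set set. (\<forall>n. nowhere_dense_family (N n)) \<and> A = (\<Union>n. N n))"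
proof
  assume "meager_family A"
  then obtain N :: "nat \<Rightarrow> (nat \<Rightarrow> bool) set"
    where nd: "\<forall>n. nowhere_dense_in cantor_topology (N n)"
      and A: "(\<lambda>x n. n \<in> x) ` A = (\<Union>n. N n)"
    unfolding meager_family_def meager_in_def by (elim exE conjE)
  \<comment> \<open>\<open>Collect\<close> inverts the characteristic-function map, so the cover
    pulls back to families of sets.\<close>
  let ?N = "\<lambda>n. Collect ` N n"
  have "(\<lambda>x n. n \<in> x) ` ?N n = N n" for n
    by (simp add: image_image)
  then have "nowhere_dense_family (?N n)" for n
    using nd nowhere_dense_in_char_image[of "?N n"] by simp
  moreover have "A = Collect ` ((\<lambda>x n. n \<in> x) ` A)"
    by (simp add: image_image)
  then have "A = (\<Union>n. ?N n)"
    unfolding A by (simp add: image_UN)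
  ultimately show "\<exists>N :: nat \<Rightarrow> nat set set. (\<forall>n. nowhere_dense_family (N n)) \<and> A = (\<Union>n. N n)"
    by (intro exI[of _ ?N]) blast
next
  assume "\<exists>N :: nat \<Rightarrow> nat set set. (\<forall>n. nowhere_dense_family (N n)) \<and> A = (\<Union>n. N n)"
  then obtain N :: "nat \<Rightarrow> nat set set"
    where nd: "\<forall>n. nowhere_dense_family (N n)" and A: "A = (\<Union>n. N n)"
    by (elim exE conjE)
  have "(\<lambda>x n. n \<in> x) ` A = (\<Union>n. (\<lambda>x n. n \<in> x) ` N n)"
    unfolding A by (rule image_UN)
  moreover have "\<forall>n. nowhere_dense_in cantor_topology ((\<lambda>x n. n \<in> x) ` N n)"
    unfolding nowhere_dense_in_char_image by (rule nd)
  ultimately show "meager_family A"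
    unfolding meager_family_def meager_in_def
    by (intro exI[of _ "\<lambda>n. (\<lambda>x n. n \<in> x) ` N n"] conjI)
qed

section \<open>Blocks avoiding meager families and intervals inside members of non-meager
  ones\<close>

lemma Int_lessThan_eq_mono:
  fixes x y :: "'a :: order set"
  assumes "x \<inter> {..<n} = y \<inter> {..<n}" "m \<le> n"
  shows "x \<inter> {..<m} = y \<inter> {..<m}"
proof -
  have "{..<m} = {..<n} \<inter> {..<m}" using assms(2) by auto
  then show ?thesis using assms(1) by (metis Int_assoc)
qed

lemma nowhere_dense_family_Un:
  assumes "nowhere_dense_family A" "nowhere_dense_family B"
  shows "nowhere_dense_family (A \<union> B)"
  unfolding nowhere_dense_family_def
proof (intro allI)
  fix z n
  obtain w m where w: "w \<inter> {..<n} = z \<inter> {..<n}" "\<forall>y. y \<inter> {..<m} = w \<inter> {..<m} \<longrightarrow> y \<notin> A"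
    using assms(1)[unfolded nowhere_dense_family_def, rule_format, of n z] by (elim exE conjE)
  \<comment> \<open>Prescribing \<open>w\<close> up to \<open>max n m\<close> preserves both the
    trace of \<open>z\<close> and the exclusion from \<open>A\<close>.\<close>
  obtain v l where v: "v \<inter> {..<max n m} = w \<inter> {..<max n m}"
      "\<forall>y. y \<inter> {..<l} = v \<inter> {..<l} \<longrightarrow> y \<notin> B"
    using assms(2)[unfolded nowhere_dense_family_def, rule_format, of "max n m" w]
    by (elim exE conjE)
  have "v \<inter> {..<n} = z \<inter> {..<n}"
    using Int_lessThan_eq_mono[OF v(1), of n] w(1) by simp
  moreover have "y \<notin> A \<union> B" if y: "y \<inter> {..<max m l} = v \<inter> {..<max m l}" for y
  proof -
    have "y \<inter> {..<m} = w \<inter> {..<m}"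
      using Int_lessThan_eq_mono[OF y, of m] Int_lessThan_eq_mono[OF v(1), of m] by simp
    moreover have "y \<inter> {..<l} = v \<inter> {..<l}"
      using Int_lessThan_eq_mono[OF y, of l] by simp
    ultimately show ?thesis using w(2) v(2) by simp
  qed
  ultimately show "\<exists>w m. w \<inter> {..<n} = z \<inter> {..<n} \<and>
      (\<forall>y. y \<inter> {..<m} = w \<inter> {..<m} \<longrightarrow> y \<notin> A \<union> B)"
    by blast
qed

lemma nowhere_dense_family_UN_atMost:
  assumes "\<And>n. nowhere_dense_family (N n)"
  shows "nowhere_dense_family (\<Union>j\<le>(k::nat). N j)"
  by (induction k) (auto simp: atMost_Suc assms intro: nowhere_dense_family_Un)

text \<open>There are only finitely many traces on \<open>{..<n}\<close>; the pattern is extended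
  once for each, so that in the end it works regardless of what \<open>y\<close> does below
  \<open>n\<close>.\<close>

lemma nowhere_dense_family_avoiding_block:
  assumes N: "nowhere_dense_family N"
  shows "\<exists>m s. s \<noteq> {} \<and> s \<subseteq> {n..<m} \<and> (\<forall>y. y \<inter> {n..<m} = s \<longrightarrow> y \<notin> N)"
proof -
  have "\<exists>m s. s \<noteq> {} \<and> s \<subseteq> {n..<m} \<and> (\<forall>t\<in>T. \<forall>y. y \<inter> {..<m} = t \<union> s \<longrightarrow> y \<notin> N)"
    if "finite T" "T \<subseteq> Pow {..<n}" for T
    using that
  proof (induction T rule: finite_induct)
    case empty
    \<comment> \<open>Starting from \<open>{n}\<close> makes the pattern nonempty; extensions keep
      it so.\<close>
    show ?case by (intro exI[of _ "Suc n"] exI[of _ "{n}"]) auto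
  next
    case (insert t T)
    then have "T \<subseteq> Pow {..<n}" by simp
    from insert.IH[OF this] obtain m s where s: "s \<noteq> {}" "s \<subseteq> {n..<m}"
        "\<forall>t\<in>T. \<forall>y. y \<inter> {..<m} = t \<union> s \<longrightarrow> y \<notin> N" by (elim exE conjE)
    obtain w l where w: "w \<inter> {..<m} = (t \<union> s) \<inter> {..<m}"
        "\<forall>y. y \<inter> {..<l} = w \<inter> {..<l} \<longrightarrow> y \<notin> N"
      using N[unfolded nowhere_dense_family_def, rule_format, of m "t \<union> s"] by (elim exE conjE)
    have nm: "n < m" using s(1,2) by auto
    \<comment> \<open>The new pattern is read off \<open>w\<close>. It extends \<open>s\<close>, so
      the traces in \<open>T\<close> stay handled, and together with \<open>t\<close> it gives
      \<open>w\<close> below \<open>?M\<close>, which handles \<open>t\<close>.\<close>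
    let ?M = "max m l" let ?s = "w \<inter> {n..<?M}"
    have s_eq: "?s \<inter> {..<m} = s"
    proof -
      have "?s \<inter> {..<m} = (w \<inter> {..<m}) \<inter> {n..}" by auto
      also have "\<dots> = (t \<union> s) \<inter> {..<m} \<inter> {n..}" unfolding w(1) ..
      also have "\<dots> = s" using s(2) insert.prems by fastforce
      finally show ?thesis .
    qed
    have ts: "t \<union> ?s = w \<inter> {..<?M}"
    proof -
      have "w \<inter> {..<?M} = (w \<inter> {..<m}) \<inter> {..<n} \<union> ?s" using nm by auto
      also have "(w \<inter> {..<m}) \<inter> {..<n} = t"
        unfolding w(1) using s(2) insert.prems nm by fastforce
      finally show ?thesis by simp
    qed
    have "y \<notin> N" if t': "t' \<in> insert t T" and y: "y \<inter> {..<?M} = t' \<union> ?s" for t' y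
    proof (cases "t' = t")
      case True
      then have "y \<inter> {..<?M} = w \<inter> {..<?M}" using y ts by simp
      then have "y \<inter> {..<l} = w \<inter> {..<l}" by (rule Int_lessThan_eq_mono) simp
      then show ?thesis using w(2) by simp
    next
      case False
      then have t'T: "t' \<in> T" using t' by simp
      have "y \<inter> {..<m} = (y \<inter> {..<?M}) \<inter> {..<m}" by auto
      also have "\<dots> = t' \<inter> {..<m} \<union> (?s \<inter> {..<m})" unfolding y by blast
      also have "\<dots> = t' \<union> s" unfolding s_eq using t'T insert.prems nm by fastforce
      finally show ?thesis using s(3) t'T by blast
    qed
    moreover have "?s \<noteq> {}" using s_eq s(1) by auto
    moreover have "?s \<subseteq> {n..<?M}" by blast
    ultimately show ?case by (intro exI[of _ ?M] exI[of _ ?s] conjI ballI allI impI)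
  qed
  from this[of "Pow {..<n}"] obtain m s where s: "s \<noteq> {}" "s \<subseteq> {n..<m}"
      "\<forall>t\<in>Pow {..<n}. \<forall>y. y \<inter> {..<m} = t \<union> s \<longrightarrow> y \<notin> N"
    by (simp del: ex_simps) (elim exE conjE)
  have "y \<notin> N" if "y \<inter> {n..<m} = s" for y
  proof -
    have "n < m" using s(1,2) by auto
    then have "y \<inter> {..<m} = (y \<inter> {..<n}) \<union> s" using that by auto
    moreover have "y \<inter> {..<n} \<in> Pow {..<n}" by simp
    ultimately show ?thesis using s(3) by blast
  qed
  with s(1,2) show ?thesis by (intro exI[of _ m] exI[of _ s] conjI allI impI)
qed

definition block_sequence :: "(nat \<Rightarrow> nat set) \<Rightarrow> bool" where
  "block_sequence s \<longleftrightarrow> disjoint_family s \<and> (\<forall>k. finite (s k) \<and> s k \<noteq> {})"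

text \<open>Cut the naturals into consecutive intervals, the \<open>k\<close>-th carrying a pattern
  that keeps sets out of the first \<open>k + 1\<close> nowhere dense pieces. A union of infinitely
  many blocks shows its pattern exactly on infinitely many intervals, so it escapes every
  piece.\<close>

lemma meager_family_avoiding_blocks:
  assumes "meager_family A"
  shows "\<exists>s. block_sequence s \<and> (\<forall>D. infinite D \<longrightarrow> (\<Union>k\<in>D. s k) \<notin> A)"
proof -
  obtain N :: "nat \<Rightarrow> nat set set" where N: "\<And>n. nowhere_dense_family (N n)" "A = (\<Union>n. N n)"
    using assms unfolding meager_family_iff by blast
  define P where "P k = (\<lambda>(a, b, s). s \<noteq> {} \<and> s \<subseteq> {a..<b} \<and>
      (\<forall>y. y \<inter> {a..<b} = s \<longrightarrow> y \<notin> (\<Union>j\<le>k. N j)))" for k :: nat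
  have "\<exists>m s. P k (n, m, s)" for k n
    unfolding P_def prod.case
    by (intro nowhere_dense_family_avoiding_block nowhere_dense_family_UN_atMost N(1))
  \<comment> \<open>A triple holds the left end, the right end and the pattern; each interval starts
    where the previous one ends.\<close>
  then have "\<exists>f. \<forall>k. P k (f k) \<and> fst (f (Suc k)) = fst (snd (f k))"
    by (intro dependent_nat_choice) (metis fst_conv)+
  then obtain f where f: "\<And>k. P k (f k)" "\<And>k. fst (f (Suc k)) = fst (snd (f k))" by blast
  define a where "a k = fst (f k)" for k
  define s where "s k = snd (snd (f k))" for k
  have P: "s k \<noteq> {}" "s k \<subseteq> {a k..<a (Suc k)}"
     "\<And>y j. y \<inter> {a k..<a (Suc k)} = s k \<Longrightarrow> j \<le> k \<Longrightarrow> y \<notin> N j" for k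
    using f(1)[of k] f(2)[of k] unfolding P_def a_def s_def by (auto simp: case_prod_beta)
  have "a k < a (Suc k)" for k using P(1,2)[of k] by auto
  then have mono: "a (Suc j) \<le> a k" if "j < k" for j k
    using that by (metis Suc_leI lift_Suc_mono_le less_imp_le)
  have disj: "s j \<inter> {a k..<a (Suc k)} = {}" if "j \<noteq> k" for j k
    using P(2)[of j] mono[of j k] mono[of k j] that by (cases "j < k") fastforce+
  have "disjoint_family s"
    using disj P(2) unfolding disjoint_family_on_def by blast
  moreover have "finite (s k)" for k using P(2) finite_subset by blast
  moreover have "(\<Union>k\<in>D. s k) \<notin> A" if D: "infinite D" for D
  proof
    assume "(\<Union>k\<in>D. s k) \<in> A"
    then obtain j where j: "(\<Union>k\<in>D. s k) \<in> N j" using N(2) by blast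
    obtain k where k: "k \<in> D" "j \<le> k" using D by (meson infinite_nat_iff_unbounded_le)
    have "s i \<inter> {a k..<a (Suc k)} \<subseteq> s k" for i
      using disj[of i k] by (cases "i = k") auto
    then have "(\<Union>k\<in>D. s k) \<inter> {a k..<a (Suc k)} = s k"
      using P(2)[of k] k(1) by fast
    then show False using P(3) k(2) j by blast
  qed
  ultimately show ?thesis using P(1) unfolding block_sequence_def by blast
qed

text \<open>Otherwise each member of \<open>A\<close> contains none of the intervals from some
  \<open>n\<close> on. For fixed \<open>n\<close> such members form a nowhere dense family, since
  any finite trace can be extended by one of the forbidden intervals.\<close>

lemma nonmeager_family_contains_intervals:
  assumes "\<not> meager_family A"
  shows "\<exists>x\<in>A. \<exists>\<^sub>\<infinity>k. {k..g k} \<subseteq> x"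
proof (rule ccontr)
  assume *: "\<not> ?thesis"
  define N where "N n = {x \<in> A. \<forall>k\<ge>n. \<not> {k..g k} \<subseteq> x}" for n :: nat
  have "A = (\<Union>n. N n)"
    using * by (auto simp: N_def INFM_nat_le)
  moreover have "nowhere_dense_family (N n)" for n
    unfolding nowhere_dense_family_def
  proof (intro allI)
    fix z l
    \<comment> \<open>Beginning at \<open>l\<close> or later leaves the trace of \<open>z\<close>
      intact; beginning at \<open>n\<close> or later makes the interval one that \<open>N n\<close>
      forbids.\<close>
    let ?k = "max n l"
    let ?w = "(z \<inter> {..<l}) \<union> {?k..g ?k}"
    have avoid: "y \<notin> N n" if "y \<inter> {..<Suc (g ?k)} = ?w \<inter> {..<Suc (g ?k)}" for y
    proof -
      have "{?k..g ?k} \<subseteq> ?w \<inter> {..<Suc (g ?k)}" by auto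
      then have "{?k..g ?k} \<subseteq> y" using that by blast
      then show ?thesis unfolding N_def by (auto intro!: exI[of _ ?k])
    qed
    have "?w \<inter> {..<l} = z \<inter> {..<l}"
      by auto
    then show "\<exists>w m. w \<inter> {..<l} = z \<inter> {..<l} \<and> (\<forall>y. y \<inter> {..<m} = w \<inter> {..<m} \<longrightarrow> y \<notin> N n)"
      by (intro exI[of _ ?w] exI[of _ "Suc (g ?k)"] conjI allI impI avoid)
  qed
  ultimately show False using assms unfolding meager_family_iff by blast
qed

section \<open>Almost disjoint families and unions of blocks\<close>

lemma almost_subset_trans: "x \<subseteq>* y \<Longrightarrow> y \<subseteq>* z \<Longrightarrow> x \<subseteq>* z"
  unfolding almost_subset_def
  by (rule finite_subset[of _ "(x - y) \<union> (y - z)"]) auto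

text \<open>Branches of the binary tree: \<open>X\<close> is sent to the codes of its initial
  segments. Tagging each with its length makes \<open>c X\<close> injective, and distinct sets share
  only segments that end before their first difference.\<close>

lemma almost_disjoint_family_continuum:
  "\<exists>D :: nat set \<Rightarrow> nat set. (\<forall>X. infinite (D X)) \<and> (\<forall>X Y. X \<noteq> Y \<longrightarrow> finite (D X \<inter> D Y))"
proof -
  define c where "c X n = prod_encode (n, set_encode (X \<inter> {..<n}))" for X n
  have "infinite (range (c X))" for X
    by (intro range_inj_infinite injI) (simp add: c_def)
  moreover have "finite (range (c X) \<inter> range (c Y))" if neq: "X \<noteq> Y" for X Y
  proof -
    obtain i where i: "(i \<in> X) \<noteq> (i \<in> Y)" using neq by blast
    have "range (c X) \<inter> range (c Y) \<subseteq> c X ` {..i}"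
    proof
      fix m assume "m \<in> range (c X) \<inter> range (c Y)"
      then obtain n l where n: "m = c X n" "m = c Y l" by blast
      then have "set_encode (X \<inter> {..<n}) = set_encode (Y \<inter> {..<n})" by (auto simp: c_def)
      then have "X \<inter> {..<n} = Y \<inter> {..<n}" by (simp add: set_encode_eq)
      then have "n \<le> i" using i by (metis Int_iff lessThan_iff not_le)
      with n(1) show "m \<in> c X ` {..i}" by simp
    qed
    then show ?thesis by (rule finite_subset) simp
  qed
  ultimately show ?thesis by (intro exI[of _ "\<lambda>X. range (c X)"]) simp
qed

lemma infinite_Union_blocks:
  assumes s: "block_sequence s" and D: "infinite D"
  shows "infinite (\<Union>k\<in>D. s k)"
proof
  assume fin: "finite (\<Union>k\<in>D. s k)"
  have "\<forall>k. \<exists>n. n \<in> s k" using s by (auto simp: block_sequence_def)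
  then obtain p where p: "\<And>k. p k \<in> s k" by metis
  have "inj_on p D"
    using s p unfolding block_sequence_def disjoint_family_on_def inj_on_def
    by (metis UNIV_I disjoint_iff)
  moreover have "p ` D \<subseteq> (\<Union>k\<in>D. s k)" using p by blast
  ultimately show False using D fin by (meson finite_imageD finite_subset)
qed

lemma finite_Int_Union_blocks:
  assumes s: "block_sequence s" and fin: "finite (D \<inter> E)"
  shows "finite ((\<Union>k\<in>D. s k) \<inter> (\<Union>k\<in>E. s k))"
proof (rule finite_subset)
  show "(\<Union>k\<in>D. s k) \<inter> (\<Union>k\<in>E. s k) \<subseteq> (\<Union>k\<in>D \<inter> E. s k)"
  proof
    fix n assume "n \<in> (\<Union>k\<in>D. s k) \<inter> (\<Union>k\<in>E. s k)"
    then obtain k l where k: "k \<in> D" "n \<in> s k" and l: "l \<in> E" "n \<in> s l" by blast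
    have "k = l"
      using s k(2) l(2) unfolding block_sequence_def disjoint_family_on_def by blast
    then show "n \<in> (\<Union>k\<in>D \<inter> E. s k)" using k l by blast
  qed
  show "finite (\<Union>k\<in>D \<inter> E. s k)"
    using fin s by (simp add: block_sequence_def)
qed

text \<open>An infinite set is almost contained in at most one member of an almost disjoint family, so
  some member of a family of size continuum almost contains none of the given sets.\<close>

lemma exists_block_union_avoiding:
  fixes x :: "'i \<Rightarrow> nat set"
  assumes J: "|J| <o |UNIV :: nat set set|" and x: "\<And>j. j \<in> J \<Longrightarrow> infinite (x j)"
    and s: "block_sequence s"
  shows "\<exists>D. infinite D \<and> infinite (- (\<Union>k\<in>D. s k)) \<and> (\<forall>j\<in>J. \<not> x j \<subseteq>* (\<Union>k\<in>D. s k))"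
proof -
  obtain D :: "nat set \<Rightarrow> nat set"
    where D: "\<And>X. infinite (D X)" "\<And>X Y. X \<noteq> Y \<Longrightarrow> finite (D X \<inter> D Y)"
    using almost_disjoint_family_continuum by blast
  define U where "U X = (\<Union>k\<in>D X. s k)" for X
  have U: "infinite (U X)" "X \<noteq> Y \<Longrightarrow> finite (U X \<inter> U Y)" for X Y
    unfolding U_def
    by (rule infinite_Union_blocks[OF s D(1)]) (rule finite_Int_Union_blocks[OF s D(2)])
  have "\<exists>X. \<forall>j\<in>J. \<not> x j \<subseteq>* U X"
  proof (rule ccontr)
    assume "\<not> ?thesis"
    then have "\<forall>X. \<exists>j. j \<in> J \<and> x j \<subseteq>* U X" by blast
    then obtain f where f: "\<And>X. f X \<in> J" "\<And>X. x (f X) \<subseteq>* U X" by metis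
    have "inj f"
    proof (rule injI, rule ccontr)
      fix X Y assume eq: "f X = f Y" and "X \<noteq> Y"
      then have "finite ((x (f X) - U X) \<union> (x (f X) - U Y) \<union> (U X \<inter> U Y))"
        using f(2)[of X] f(2)[of Y] U(2) by (simp add: almost_subset_def)
      then have "finite (x (f X))" by (rule rev_finite_subset) blast
      then show False using x f(1) by blast
    qed
    moreover have "range f \<subseteq> J" using f(1) by blast
    ultimately have "|UNIV :: nat set set| \<le>o |J|" using card_of_ordLeq by blast
    then show False using J not_ordLess_ordLeq by blast
  qed
  then obtain X where X: "\<forall>j\<in>J. \<not> x j \<subseteq>* U X" ..
  \<comment> \<open>Since \<open>- X\<close> differs from \<open>X\<close>, \<open>U (- X)\<close>
    is an infinite set almost disjoint from \<open>U X\<close>, which forces \<open>U X\<close> to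
    be co-infinite.\<close>
  have "infinite (U (- X) - U X)"
  proof
    assume "finite (U (- X) - U X)"
    moreover have "finite (U (- X) \<inter> U X)" by (rule U(2)) blast
    ultimately have "finite ((U (- X) - U X) \<union> (U (- X) \<inter> U X))" by simp
    then have "finite (U (- X))" by (rule rev_finite_subset) blast
    then show False using U(1) by blast
  qed
  then have "infinite (- U X)" by (rule infinite_super[rotated]) blast
  with X D(1) show ?thesis unfolding U_def by blast
qed

section \<open>Transversals of cofinal families and the lower bound by the continuum\<close>

lemma infinite_of_mem_B_M_plus: "A \<in> B_M_plus \<Longrightarrow> x \<in> A \<Longrightarrow> infinite x"
  unfolding B_M_plus_def downward_closed_def infinite_subsets_def by blast

text \<open>If this family were meager, some block sequence would have no infinite union in it,
  against the assumption; downward closure is transitivity of \<open>\<subseteq>*\<close>.\<close>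

lemma avoiding_family_in_B_M_plus:
  assumes "\<And>s. block_sequence s \<Longrightarrow> \<exists>D. infinite D \<and> (\<forall>x\<in>K. \<not> x \<subseteq>* (\<Union>k\<in>D. s k))"
  shows "{z. infinite z \<and> (\<forall>x\<in>K. \<not> x \<subseteq>* z)} \<in> B_M_plus" (is "?G \<in> _")
proof -
  have "downward_closed ?G"
    unfolding downward_closed_def infinite_subsets_def using almost_subset_trans by blast
  moreover have "\<not> meager_family ?G"
  proof
    assume "meager_family ?G"
    then obtain s where s: "block_sequence s" "\<And>D. infinite D \<Longrightarrow> (\<Union>k\<in>D. s k) \<notin> ?G"
      using meager_family_avoiding_blocks by blast
    obtain D where D: "infinite D" "\<forall>x\<in>K. \<not> x \<subseteq>* (\<Union>k\<in>D. s k)"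
      using assms[OF s(1)] by blast
    then show False
      using s(2)[OF D(1)] infinite_Union_blocks[OF s(1) D(1)] by simp
  qed
  ultimately show ?thesis by (simp add: B_M_plus_def)
qed

text \<open>Otherwise the infinite sets almost containing no point of \<open>K\<close> form a member
  of \<open>B_M_plus\<close>, which includes some \<open>A\<close> in \<open>C\<close>; but a point
  of \<open>A \<inter> K\<close> almost contains itself.\<close>

lemma transversal_of_cofinal_family:
  assumes C: "C \<in> cofinal_families B_M_plus" and K: "\<And>A. A \<in> C \<Longrightarrow> A \<inter> K \<noteq> {}"
  shows "\<exists>s. block_sequence s \<and> (\<forall>D. infinite D \<longrightarrow> (\<exists>x\<in>K. x \<subseteq>* (\<Union>k\<in>D. s k)))"
proof (rule ccontr)
  let ?G = "{z. infinite z \<and> (\<forall>x\<in>K. \<not> x \<subseteq>* z)}"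
  assume "\<not> ?thesis"
  then have "?G \<in> B_M_plus" by (intro avoiding_family_in_B_M_plus) blast
  then obtain A where A: "A \<in> C" "A \<subseteq> ?G"
    using C unfolding cofinal_families_def by blast
  obtain x where x: "x \<in> A" "x \<in> K" using K[OF A(1)] by blast
  moreover have "x \<subseteq>* x" by (simp add: almost_subset_def)
  ultimately show False using A(2) by blast
qed

lemma continuum_le_cofinal_family:
  assumes C: "C \<in> cofinal_families B_M_plus"
  shows "|UNIV :: nat set set| \<le>o |C|"
proof (rule ccontr)
  assume "\<not> ?thesis"
  then have less: "|C| <o |UNIV :: nat set set|"
    using not_ordLeq_iff_ordLess[OF card_of_Well_order card_of_Well_order] by blast
  have C_sub: "C \<subseteq> B_M_plus" using C by (simp add: cofinal_families_def)
  \<comment> \<open>The interval lemma serves here only to give that non-meager families are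
    nonempty.\<close>
  have "\<forall>A\<in>C. \<exists>x. x \<in> A"
    using C_sub nonmeager_family_contains_intervals unfolding B_M_plus_def by blast
  then obtain x where x: "\<And>A. A \<in> C \<Longrightarrow> x A \<in> A" by metis
  obtain s where s: "block_sequence s"
      "\<And>D. infinite D \<Longrightarrow> \<exists>x\<in>x ` C. x \<subseteq>* (\<Union>k\<in>D. s k)"
    using transversal_of_cofinal_family[OF C, of "x ` C"] x by blast
  have "infinite (x A)" if "A \<in> C" for A
    using that x C_sub infinite_of_mem_B_M_plus by blast
  then obtain D where "infinite D" "\<forall>A\<in>C. \<not> x A \<subseteq>* (\<Union>k\<in>D. s k)"
    using exists_block_union_avoiding[OF less _ s(1), of x] by blast
  then show False using s(2) by blast
qed

section \<open>The bounding number and the recursion of length continuum\<close>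

text \<open>Let \<open>f j n\<close> be the first point outside \<open>y j\<close> from
  \<open>n\<close> on. Fewer than bounding-number many such functions have a common bound
  \<open>g\<close>, and a set containing \<open>{k..g k}\<close> for infinitely many
  \<open>k\<close> catches \<open>f j k\<close> for infinitely many of them.\<close>

lemma nonmeager_family_avoiding_coinfinite:
  fixes y :: "'i \<Rightarrow> nat set"
  assumes J: "|J| <o bounding_number" and y: "\<And>j. j \<in> J \<Longrightarrow> infinite (- y j)"
    and A: "\<not> meager_family A"
  shows "\<exists>x\<in>A. \<forall>j\<in>J. \<not> x \<subseteq>* y j"
proof -
  define f where "f j n = (LEAST m. n \<le> m \<and> m \<notin> y j)" for j n
  have f: "n \<le> f j n" "f j n \<notin> y j" if "j \<in> J" for j n
  proof -
    have "\<exists>m. n \<le> m \<and> m \<notin> y j"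
      using y[OF that] unfolding infinite_nat_iff_unbounded_le by blast
    from LeastI_ex[OF this] show "n \<le> f j n" "f j n \<notin> y j" by (simp_all add: f_def)
  qed
  have "f ` J \<notin> unbounded_families"
  proof
    assume "f ` J \<in> unbounded_families"
    then have "bounding_number \<le>o |f ` J|"
      unfolding bounding_number_def
      using least_card_attained[OF unbounded_families_nonempty] by metis
    then have "bounding_number \<le>o |J|" using card_of_image ordLeq_transitive by blast
    then show False using J not_ordLess_ordLeq by blast
  qed
  then obtain g where g: "\<And>j. j \<in> J \<Longrightarrow> \<forall>\<^sub>F n in sequentially. f j n \<le> g n"
    unfolding unbounded_families_def eventually_majorizes_def by blast
  obtain x where x: "x \<in> A" "\<exists>\<^sub>\<infinity>k. {k..g k} \<subseteq> x"
    using nonmeager_family_contains_intervals[OF A] by blast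
  have "\<not> x \<subseteq>* y j" if j: "j \<in> J" for j
  proof
    assume "x \<subseteq>* y j"
    then obtain b where b: "\<And>m. m \<in> x - y j \<Longrightarrow> m < b"
      unfolding almost_subset_def finite_nat_set_iff_bounded by blast
    obtain N where N: "\<And>n. N \<le> n \<Longrightarrow> f j n \<le> g n"
      using g[OF j] unfolding eventually_sequentially by blast
    obtain k where k: "max b N \<le> k" "{k..g k} \<subseteq> x"
      using x(2) unfolding INFM_nat_le by blast
    have "f j k \<in> x - y j"
      using f[OF j, of k] N[of k] k by auto
    then show False using b[of "f j k"] f(1)[OF j, of k] k(1) by simp
  qed
  with x(1) show ?thesis by blast
qed

text \<open>\<open>P\<close> below chooses, along a well-order of type continuum, a pair of a member of the \<open>i\<close>-th set
  of \<open>C\<close> and a union of blocks of the \<open>i\<close>-th block sequence, so that no first component is almost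
  contained in a second component, whichever of the two was chosen earlier.\<close>

lemma continuum_less_cofinal_family:
  assumes C: "C \<in> cofinal_families B_M_plus"
    and cb: "|UNIV :: nat set set| \<le>o bounding_number"
  shows "\<not> |C| \<le>o |UNIV :: nat set set|"
proof
  assume C_le: "|C| \<le>o |UNIV :: nat set set|"
  define r where "r = |UNIV :: nat set set|"
  have C_sub: "C \<subseteq> B_M_plus" using C by (simp add: cofinal_families_def)
  have "C \<noteq> {}"
    using continuum_le_cofinal_family[OF C] card_of_empty3 by fastforce
  then obtain h :: "nat set \<Rightarrow> nat set set" where h: "range h = C"
    using C_le card_of_ordLeq2[of C "UNIV :: nat set set"] by blast
  have hB: "h i \<in> B_M_plus" for i using h C_sub by blast
  \<comment> \<open>Every set of naturals codes a sequence of sets; surjectivity ensures that each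
    block sequence is treated at some stage.\<close>
  define e where "e X k = {n. prod_encode (k, n) \<in> X}" for X k
  have e_surj: "\<exists>X. e X = s" for s
    by (rule exI[of _ "{prod_encode (k, n) |k n. n \<in> s k}"]) (auto simp: e_def)
  have wo: "well_order_on UNIV r" unfolding r_def by (rule card_of_well_order_on)
  have "wf (r - Id)" using wo by (simp add: well_order_on_def)
  have inf: "infinite (UNIV :: nat set set)" by (simp add: Finite_Set.finite_set)
  \<comment> \<open>A cardinal order has only small proper initial segments, so each stage has fewer
    than continuum many predecessors.\<close>
  have card_le: "|insert i (underS r i)| <o |UNIV :: nat set set|" for i
  proof -
    have "|underS r i| <o r"
      using card_of_underS[of r i] wo by (simp add: r_def Field_card_of card_of_card_order_on)
    moreover have "|{i}| <o |UNIV :: nat set set|"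
      using card_of_ordLeq_finite[of "UNIV :: nat set set" "{i}"] inf
        not_ordLeq_iff_ordLess[OF card_of_Well_order card_of_Well_order] by blast
    ultimately show ?thesis
      using card_of_Un_ordLess_infinite[OF inf, of "{i}" "underS r i"] by (simp add: r_def)
  qed
  define P where "P f i p \<longleftrightarrow> fst p \<in> h i \<and> infinite (- snd p) \<and>
      (block_sequence (e i) \<longrightarrow> (\<exists>D. infinite D \<and> snd p = (\<Union>k\<in>D. e i k))) \<and>
      \<not> fst p \<subseteq>* snd p \<and> (\<forall>j\<in>underS r i. \<not> fst (f j) \<subseteq>* snd p \<and> \<not> fst p \<subseteq>* snd (f j))"
    for f :: "nat set \<Rightarrow> nat set \<times> nat set" and i p
  have "\<exists>f. \<forall>i. P f i (f i)"
  proof (rule dependent_wf_choice[OF \<open>wf (r - Id)\<close>])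
    fix f g :: "nat set \<Rightarrow> nat set \<times> nat set" and i p
    assume "\<And>j. (j, i) \<in> r - Id \<Longrightarrow> f j = g j"
    then have "\<forall>j\<in>underS r i. f j = g j" by (auto simp: underS_def)
    then show "P f i p = P g i p" by (simp add: P_def)
  next
    fix i and f :: "nat set \<Rightarrow> nat set \<times> nat set"
    assume "\<And>j. (j, i) \<in> r - Id \<Longrightarrow> P f j (f j)"
    then have Pf: "P f j (f j)" if "j \<in> underS r i" for j
      using that by (auto simp: underS_def)
    let ?J = "insert i (underS r i)"
    have x_inf: "infinite (fst (f j))" if "j \<in> underS r i" for j
      using Pf[OF that] hB infinite_of_mem_B_M_plus unfolding P_def by blast
    \<comment> \<open>The second component is chosen first, against all earlier first
      components.\<close>
    have "\<exists>y. infinite (- y) \<and> (block_sequence (e i) \<longrightarrow> (\<exists>D. infinite D \<and> y = (\<Union>k\<in>D. e i k))) \<and>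
        (\<forall>j\<in>underS r i. \<not> fst (f j) \<subseteq>* y)"
    proof (cases "block_sequence (e i)")
      case True
      have "|underS r i| <o |UNIV :: nat set set|"
        using card_of_mono1[of "underS r i" ?J] card_le[of i] ordLeq_ordLess_trans by blast
      from exists_block_union_avoiding[OF this _ True, of "\<lambda>j. fst (f j)"] x_inf
      show ?thesis by blast
    next
      case False
      \<comment> \<open>If \<open>e i\<close> is no block sequence, the empty set serves as default:
        no infinite set is almost contained in it.\<close>
      then show ?thesis
        using x_inf by (intro exI[of _ "{}"]) (auto simp: almost_subset_def)
    qed
    then obtain y where y: "infinite (- y)"
        "block_sequence (e i) \<longrightarrow> (\<exists>D. infinite D \<and> y = (\<Union>k\<in>D. e i k))"
        "\<forall>j\<in>underS r i. \<not> fst (f j) \<subseteq>* y" by (elim exE conjE)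
    \<comment> \<open>Adding the new \<open>y\<close> at index \<open>i\<close> lets a single choice
      of \<open>x\<close> avoid the earlier second components and \<open>y\<close> together.\<close>
    define y' where "y' = (\<lambda>j. snd (f j))(i := y)"
    have y': "infinite (- y' j)" if "j \<in> ?J" for j
      using that Pf y(1) by (auto simp: y'_def P_def)
    have "\<not> meager_family (h i)" using hB by (simp add: B_M_plus_def)
    from nonmeager_family_avoiding_coinfinite[where J = ?J and y = y',
        OF ordLess_ordLeq_trans[OF card_le cb] y' this]
    obtain x where x: "x \<in> h i" "\<forall>j\<in>?J. \<not> x \<subseteq>* y' j" by (rule bexE)
    have "\<not> x \<subseteq>* y" using x(2) by (simp add: y'_def)
    moreover have "\<forall>j\<in>underS r i. \<not> x \<subseteq>* snd (f j)"
      using x(2) by (auto simp: y'_def underS_def)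
    ultimately have "P f i (x, y)"
      using x(1) y by (simp add: P_def)
    then show "\<exists>p. P f i p" ..
  qed
  then obtain f where f: "\<And>i. P f i (f i)" by blast
  have "A \<inter> range (\<lambda>i. fst (f i)) \<noteq> {}" if "A \<in> C" for A
    using that h f unfolding P_def by blast
  from transversal_of_cofinal_family[OF C this]
  obtain s where s: "block_sequence s"
    "\<And>D. infinite D \<Longrightarrow> \<exists>j. fst (f j) \<subseteq>* (\<Union>k\<in>D. s k)" by auto
  \<comment> \<open>Stage \<open>i\<close> treats \<open>s\<close>, so \<open>snd (f i)\<close> is
    an infinite union of its blocks and must almost contain some \<open>fst (f j)\<close>. The
    stages coincide or one is earlier; each case contradicts a clause of \<open>P\<close>.\<close>
  obtain i where i: "e i = s" using e_surj by blast
  obtain D where D: "infinite D" "snd (f i) = (\<Union>k\<in>D. s k)"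
    using f[of i] s(1) i unfolding P_def by blast
  obtain j where j: "fst (f j) \<subseteq>* snd (f i)" using s(2)[OF D(1)] D(2) by auto
  have "j = i \<or> j \<in> underS r i \<or> i \<in> underS r j"
    using wo by (auto simp: well_order_on_def linear_order_on_def total_on_def underS_def)
  then show False
    using f[of i] f[of j] j unfolding P_def by blast
qed

section \<open>Comparison with the continuum and the conclusion\<close>

lemma cexp_ctwo_natLeq_le: "ctwo ^c natLeq \<le>o |UNIV :: nat set set|"
  using ordIso_ordLeq_trans[OF ordIso_symmetric[OF card_of_Pow_Func[of "UNIV :: nat set"]]
      card_of_mono1[OF subset_UNIV]]
  by (simp add: cexp_def ctwo_def Field_natLeq Field_card_of)

text \<open>The family of all functions is unbounded, and coding each function by its graph injects
  it into the sets of naturals.\<close>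

lemma bounding_number_le_continuum: "bounding_number \<le>o |UNIV :: nat set set|"
proof -
  have "UNIV \<in> unbounded_families"
    unfolding unbounded_families_def eventually_majorizes_def
  proof safe
    fix g :: "nat \<Rightarrow> nat"
    assume "\<forall>f\<in>UNIV. \<forall>\<^sub>F n in sequentially. f n \<le> g n"
    then have "\<forall>\<^sub>F n in sequentially. Suc (g n) \<le> g n"
      by (rule bspec[where x="\<lambda>n. Suc (g n)"]) simp
    then show False by simp
  qed
  then have "bounding_number \<le>o |UNIV :: (nat \<Rightarrow> nat) set|"
    unfolding bounding_number_def
    using least_card_attained[OF unbounded_families_nonempty] by metis
  moreover have "inj (\<lambda>f :: nat \<Rightarrow> nat. range (\<lambda>n. prod_encode (n, f n)))"
  proof (intro injI ext)
    fix f g :: "nat \<Rightarrow> nat" and n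
    assume "range (\<lambda>n. prod_encode (n, f n)) = range (\<lambda>n. prod_encode (n, g n))"
    then have "prod_encode (n, f n) \<in> range (\<lambda>n. prod_encode (n, g n))" by blast
    then show "f n = g n" by auto
  qed
  then have "|UNIV :: (nat \<Rightarrow> nat) set| \<le>o |UNIV :: nat set set|"
    using card_of_ordLeq by blast
  ultimately show ?thesis by (rule ordLeq_transitive)
qed

theorem theorem5:
  shows "ctwo ^c natLeq \<le>o cof B_M_plus \<and> bounding_number <o cof B_M_plus"
proof
  obtain C where C: "C \<in> cofinal_families B_M_plus" "cof B_M_plus = |C|"
    unfolding cof_def using least_card_attained[OF cofinal_families_nonempty] by blast
  note c_le = continuum_le_cofinal_family[OF C(1)]
  show "ctwo ^c natLeq \<le>o cof B_M_plus"
    unfolding C(2)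
    by (rule ordLeq_transitive[OF cexp_ctwo_natLeq_le c_le])
  obtain F where F: "bounding_number = |F :: (nat \<Rightarrow> nat) set|"
    unfolding bounding_number_def using least_card_attained[OF unbounded_families_nonempty] by blast
  show "bounding_number <o cof B_M_plus"
  proof (rule ccontr)
    assume "\<not> ?thesis"
    then have C_le: "|C| \<le>o bounding_number"
      unfolding C(2) F using not_ordLeq_iff_ordLess[OF card_of_Well_order card_of_Well_order] by blast
    \<comment> \<open>Here continuum \<le> \<open>|C|\<close> \<le> \<open>bounding_number\<close>
      \<le> continuum, exactly the case excluded by the recursion.\<close>
    show False
      using continuum_less_cofinal_family[OF C(1) ordLeq_transitive[OF c_le C_le]]
        ordLeq_transitive[OF C_le bounding_number_le_continuum] ..
  qed
qed

end
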